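(* Let $f:\mathbb{R}^d\to\mathbb{R}$ be $C^1$ with $\nabla f$ Lipschitz continuous on $\mathbb{R}^d$ with constant $L>0$, bounded from below, with set of minimizers $\mathcal M=\{x: f(x)=\inf f\}$. Let $\mu>0$, $0<\eta\le 1/L$ and $\rho=\frac{1-\sqrt{\mu\eta}}{1+\sqrt{\mu\eta}}$. Let $x_0\in\mathbb{R}^d$, $v_0=0$, and let the sequences $x_n,x_n',v_n$ be generated by the Nesterov scheme $$x_n'=x_n+\sqrt{\eta}\,v_n,\qquad g_n=\nabla f(x_n'),\qquad x_{n+1}=x_n'-\eta g_n,\qquad v_{n+1}=\rho\,(v_n-\sqrt{\eta}\,g_n).$$ Assume that the closest point projection onto $\mathcal M$ is an affine linear map $\pi(x)=Px+x^*$ as described in the context and that $$\langle\nabla f(x),x-\pi(x)\rangle\ge f(x)-f(\pi(x))+\frac{\mu}{2}\|x-\pi(x)\|^2\qquad\text{for all }x\in\mathbb{R}^d.$$ Finally, assume that for arbitrary $x,v\in\mathbb{R}^d$ $$\langle\nabla f(x+v),v\rangle\ge f(x+v)-f(x)-\frac{\varepsilon}{2}\|v\|^2$$ with some $\varepsilon\le\sqrt{\mu/\eta}$. Then for all $n\ge 0$ $$f(x_n)-\inf f\le(1-\sqrt{\mu\eta})^n\left[f(x_0)-\inf f+\frac{\mu}{2}\|x_0-\pi(x_0)\|^2\right].$$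
   Context: Affine projection: $V\subset\mathbb{R}^d$ is a linear subspace of dimension $k<d$, $P:\mathbb{R}^d\to\mathbb{R}^d$ is the orthogonal projection onto $V$, $x^*$ is the (unique) element of smallest Euclidean norm in the affine space $x^*+V$ (equivalently $x^*\perp V$), the set of minimizers $\mathcal M=\{x\in\mathbb{R}^d: f(x)=\inf_{z} f(z)\}$ is non-empty and equals $x^*+V$, and $\pi(x)=Px+x^*$ is the closest point projection onto $\mathcal M$. *)

theory Defs
  imports "HOL-Analysis.Analysis"
begin

definition minimizers :: "('a \<Rightarrow> real) \<Rightarrow> 'a set" where
  "minimizers f = {x. f x = (INF z. f z)}"

definition orthogonal_projection_onto ::
    "'a::real_inner set \<Rightarrow> ('a \<Rightarrow> 'a) \<Rightarrow> bool" where
  "orthogonal_projection_onto V P \<longleftrightarrow>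
     (\<forall>x. P x \<in> V \<and> (\<forall>v\<in>V. orthogonal (x - P x) v))"

end

theory Submission
  imports Defs
begin

text \<open>
  The idea is a Lyapunov function that treats the directions along the set of minimizers
  and the directions normal to it differently. Let \<open>P\<close> be the projection onto the direction
  space of the minimizers, write \<open>v = p + u\<close> with \<open>p = P v\<close> tangential and \<open>u = v - P v\<close>
  normal, put \<open>q = sqrt (\<mu> * \<eta>)\<close>, and, when \<open>q < 1\<close>, consider
  \[ E_n = f(x_n) - \inf f + \frac12 \| u_n + \sqrt\mu\,(x_n' - \pi(x_n')) \|^2
        + \frac{c}{2} \| p_n \|^2, \qquad c = \frac{(1+q)^2}{1-q}. \]
  In the normal directions this is the energy familiar from strongly convex minimization,
  with the distance to the unique minimizer replaced by the distance to the affine space.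
  In the tangential directions there is no contraction towards a particular minimizer to
  exploit, so only the kinetic energy is recorded.

  One step multiplies \<open>E\<close> by at most \<open>1 - q\<close> (\<open>nesterov_energy_step\<close>). Three
  inequalities enter: the decrease \<open>\<eta>/2 * \<parallel>\<nabla>f(x')\<parallel>\<^sup>2\<close> of a gradient step
  (\<open>gradient_step_decrease\<close>), strong convexity towards the minimizers at \<open>x'\<close> with weight
  \<open>q\<close>, and the weakened convexity condition along \<open>sqrt \<eta> * v\<close> with weight \<open>1 - q\<close>.
  The friction \<open>\<rho>\<close> is what makes the normal part of the energy propagate exactly, and \<open>c\<close>
  is fixed by \<open>c * \<rho>\<^sup>2 = 1 - q\<close>: the gradient pairs with the whole velocity in the weakened
  convexity condition but only with the normal velocity in the normal energy, and with
  this \<open>c\<close> the missing tangential pairing is supplied by the tangential kinetic energy.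
  When \<open>q = 1\<close> the velocity stays zero and the last term of \<open>E\<close> is dropped.
  As \<open>v\<^sub>0 = 0\<close>, the initial energy is the bracket on the right-hand side of the claim.

  The factor \<open>1 - q\<close> is nonnegative because \<open>\<mu> \<le> L\<close>
  (\<open>strong_convexity_constant_le_Lipschitz\<close>), which needs a point that is not a minimizer;
  the dimension assumption provides one.
\<close>

section \<open>Functions with Lipschitz gradient\<close>

text \<open>
  Along the segment from \<open>z\<close> to \<open>z + w\<close> the Lipschitz bound makes the derivative of
  \<open>f\<close> minus the quadratic model nonpositive.
\<close>
lemma Lipschitz_gradient_quadratic_upper_bound:
  fixes f :: "'a::real_inner \<Rightarrow> real"
  assumes grad: "\<And>z. GDERIV f z :> G z"
    and lip: "L-lipschitz_on UNIV G"
  shows "f (z + w) \<le> f z + G z \<bullet> w + L / 2 * (norm w)\<^sup>2"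
proof -
  define h where "h t = f (z + t *\<^sub>R w) - t * (G z \<bullet> w) - L / 2 * t\<^sup>2 * (norm w)\<^sup>2" for t :: real
  have deriv: "(h has_real_derivative
      G (z + t *\<^sub>R w) \<bullet> w - G z \<bullet> w - L * t * (norm w)\<^sup>2) (at t)" for t
  proof -
    have f: "(f has_derivative (\<lambda>y. y \<bullet> G (z + t *\<^sub>R w))) (at (z + t *\<^sub>R w))"
      using grad unfolding gderiv_def by blast
    have line: "((\<lambda>t. z + t *\<^sub>R w) has_derivative (\<lambda>y. y *\<^sub>R w)) (at t)"
      by (auto intro!: derivative_eq_intros)
    have "((\<lambda>t. f (z + t *\<^sub>R w)) has_derivative (\<lambda>y. (y *\<^sub>R w) \<bullet> G (z + t *\<^sub>R w))) (at t)"
      using has_derivative_compose[OF line f] .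
    then have "((\<lambda>t. f (z + t *\<^sub>R w)) has_real_derivative G (z + t *\<^sub>R w) \<bullet> w) (at t)"
      by (simp add: has_field_derivative_def inner_commute mult_commute_abs)
    then show ?thesis
      unfolding h_def by (auto intro!: derivative_eq_intros)
  qed
  have "h 1 \<le> h 0"
  proof (rule DERIV_nonpos_imp_nonincreasing[of 0 1 h])
    fix t :: real
    assume "0 \<le> t" "t \<le> 1"
    have "(G (z + t *\<^sub>R w) - G z) \<bullet> w \<le> norm (G (z + t *\<^sub>R w) - G z) * norm w"
      by (rule norm_cauchy_schwarz)
    also have "norm (G (z + t *\<^sub>R w) - G z) \<le> L * (t * norm w)"
      using lipschitz_onD[OF lip, of "z + t *\<^sub>R w" z] \<open>0 \<le> t\<close> by (simp add: dist_norm)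
    finally have "G (z + t *\<^sub>R w) \<bullet> w - G z \<bullet> w - L * t * (norm w)\<^sup>2 \<le> 0"
      by (simp add: inner_diff_left power2_eq_square mult_right_mono algebra_simps)
    with deriv show "\<exists>y. DERIV h t :> y \<and> y \<le> 0"
      by blast
  qed simp
  then show ?thesis
    by (simp add: h_def)
qed

lemma gradient_step_decrease:
  fixes f :: "'a::real_inner \<Rightarrow> real"
  assumes "\<And>z. GDERIV f z :> G z"
    and "L-lipschitz_on UNIV G"
    and "L > 0" "0 \<le> \<eta>" "\<eta> \<le> 1 / L"
  shows "f (z - \<eta> *\<^sub>R G z) \<le> f z - \<eta> / 2 * (norm (G z))\<^sup>2"
proof -
  have "L * \<eta> \<le> 1"
    using assms(3,5) by (simp add: field_simps)
  then have "\<eta> / 2 * (L * \<eta>) * (norm (G z))\<^sup>2 \<le> \<eta> / 2 * 1 * (norm (G z))\<^sup>2"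
    using assms(4) by (intro mult_right_mono mult_left_mono) auto
  moreover have "f (z + (- \<eta> *\<^sub>R G z))
      \<le> f z + G z \<bullet> (- \<eta> *\<^sub>R G z) + L / 2 * (norm (- \<eta> *\<^sub>R G z))\<^sup>2"
    by (rule Lipschitz_gradient_quadratic_upper_bound[OF assms(1,2)])
  ultimately show ?thesis
    by (simp add: power_mult_distrib dot_square_norm power2_eq_square[of \<eta>] algebra_simps)
qed

text \<open>
  A gradient step of size \<open>1 / L\<close> from \<open>z\<close> shows that \<open>f z\<close> exceeds \<open>m\<close> by at least
  \<open>\<parallel>\<nabla>f(z)\<parallel>\<^sup>2 / (2 * L)\<close>. The convexity inequality then bounds \<open>\<mu> * \<parallel>d\<parallel>\<^sup>2\<close> by
  \<open>2 * \<parallel>\<nabla>f(z)\<parallel> * \<parallel>d\<parallel> - \<parallel>\<nabla>f(z)\<parallel>\<^sup>2 / L\<close>, which is at most \<open>L * \<parallel>d\<parallel>\<^sup>2\<close> by completing the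
  square.
\<close>
lemma strong_convexity_constant_le_Lipschitz:
  fixes f :: "'a::real_inner \<Rightarrow> real"
  assumes grad: "\<And>z. GDERIV f z :> G z"
    and lip: "L-lipschitz_on UNIV G"
    and L: "L > 0"
    and lower: "\<And>y. m \<le> f y"
    and convex: "f z - m + \<mu> / 2 * (norm d)\<^sup>2 \<le> G z \<bullet> d"
    and d: "d \<noteq> 0"
  shows "\<mu> \<le> L"
proof -
  have "m \<le> f z - 1 / L / 2 * (norm (G z))\<^sup>2"
    using lower[of "z - (1 / L) *\<^sub>R G z"] gradient_step_decrease[OF grad lip L, of "1 / L" z] L
    by simp
  with convex have "\<mu> / 2 * (norm d)\<^sup>2 \<le> G z \<bullet> d - 1 / L / 2 * (norm (G z))\<^sup>2"
    by linarith
  then have "2 * L * (\<mu> / 2 * (norm d)\<^sup>2) \<le> 2 * L * (G z \<bullet> d - 1 / L / 2 * (norm (G z))\<^sup>2)"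
    using L by (intro mult_left_mono) auto
  also have "\<dots> = 2 * L * (G z \<bullet> d) - (norm (G z))\<^sup>2"
    using L by (simp add: field_simps)
  also have "\<dots> \<le> L * L * (norm d)\<^sup>2"
  proof -
    have "0 \<le> (norm (G z - L *\<^sub>R d))\<^sup>2"
      by simp
    then show ?thesis
      unfolding power2_norm_eq_inner
      by (simp add: inner_diff_left inner_diff_right inner_commute algebra_simps)
  qed
  finally have "L * (norm d)\<^sup>2 * \<mu> \<le> L * (norm d)\<^sup>2 * L"
    by (simp add: algebra_simps)
  moreover have "0 < L * (norm d)\<^sup>2"
    using L d by simp
  ultimately show ?thesis
    by (simp only: mult_le_cancel_left_pos)
qed

section \<open>Orthogonal projections\<close>

lemma orthogonal_projection_eqI:
  assumes V: "subspace V" and P: "orthogonal_projection_onto V P"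
    and y: "y \<in> V" "\<And>v. v \<in> V \<Longrightarrow> orthogonal (x - y) v"
  shows "P x = y"
proof -
  have PV: "P x \<in> V" and Po: "\<And>v. v \<in> V \<Longrightarrow> orthogonal (x - P x) v"
    using P unfolding orthogonal_projection_onto_def by auto
  have diff: "P x - y \<in> V"
    using V PV y(1) by (rule subspace_diff)
  have "(P x - y) \<bullet> (P x - y) = (x - y) \<bullet> (P x - y) - (x - P x) \<bullet> (P x - y)"
    by (simp add: inner_diff_left)
  then show ?thesis
    using Po[OF diff] y(2)[OF diff] by (simp add: orthogonal_def)
qed

lemma linear_orthogonal_projection:
  assumes V: "subspace V" and P: "orthogonal_projection_onto V P"
  shows "linear P"
proof
  have PV: "P x \<in> V" and Po: "v \<in> V \<Longrightarrow> orthogonal (x - P x) v" for x v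
    using P unfolding orthogonal_projection_onto_def by auto
  show "P (x + y) = P x + P y" for x y
  proof (rule orthogonal_projection_eqI[OF V P])
    show "P x + P y \<in> V"
      using V PV by (simp add: subspace_add)
    show "orthogonal (x + y - (P x + P y)) v" if "v \<in> V" for v
      using Po[OF that, of x] Po[OF that, of y]
      by (simp add: orthogonal_def inner_diff_left inner_add_left)
  qed
  show "P (r *\<^sub>R x) = r *\<^sub>R P x" for r x
  proof (rule orthogonal_projection_eqI[OF V P])
    show "r *\<^sub>R P x \<in> V"
      using V PV by (simp add: subspace_scale)
    show "orthogonal (r *\<^sub>R x - r *\<^sub>R P x) v" if "v \<in> V" for v
      using Po[OF that, of x] by (simp add: orthogonal_def inner_diff_left)
  qed
qed

section \<open>Decay of the energy\<close>

text \<open>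
  After expanding the squares, all pairings of the gradient with \<open>u\<close>, \<open>p\<close> and \<open>d\<close> cancel
  against \<open>convex\<close> with weight \<open>q\<close> and \<open>along_velocity\<close> with weight \<open>1 - q\<close>, and the
  square of \<open>h\<close> cancels against \<open>descent\<close>. The terms in \<open>u\<close> and \<open>d\<close> then agree exactly,
  and what remains are the squares of \<open>p\<close> and \<open>r\<close>, with nonpositive coefficients.

  In the intended reading, \<open>u, p\<close> and \<open>h, r\<close> are the normal and tangential parts of the
  velocity and of the gradient at the extrapolated point, \<open>d\<close> is the displacement of that
  point from the minimizers, and \<open>F\<close>, \<open>F'\<close>, \<open>F1\<close> are the function values at the old,
  extrapolated and new points, measured from the infimum; \<open>m = sqrt \<mu>\<close> and
  \<open>s = sqrt \<eta>\<close>.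
\<close>
lemma nesterov_energy_step:
  fixes u h d p r :: "'a::real_inner"
  assumes q: "q = m * s" "0 \<le> q" "q \<le> 1"
    and c: "c * \<rho>\<^sup>2 = 1 - q" "(1 - q) * (1 + q) \<le> (1 - q) * c"
    and descent: "F1 \<le> F' - s\<^sup>2 / 2 * ((norm h)\<^sup>2 + (norm r)\<^sup>2)"
    and convex: "F' + m\<^sup>2 / 2 * (norm d)\<^sup>2 \<le> h \<bullet> d"
    and along_velocity: "F' - F - q / 2 * ((norm u)\<^sup>2 + (norm p)\<^sup>2) \<le> s * (h \<bullet> u + r \<bullet> p)"
  shows "F1 + (norm ((1 - q) *\<^sub>R u + m *\<^sub>R d - s *\<^sub>R h))\<^sup>2 / 2
           + c / 2 * (norm (\<rho> *\<^sub>R (p - s *\<^sub>R r)))\<^sup>2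
         \<le> (1 - q) * (F + (norm (u + m *\<^sub>R d))\<^sup>2 / 2 + c / 2 * (norm p)\<^sup>2)"
proof -
  define U D H R S where "U = u \<bullet> u" "D = d \<bullet> d" "H = h \<bullet> h" "R = r \<bullet> r" "S = p \<bullet> p"
  define a b e k where "a = h \<bullet> u" "b = r \<bullet> p" "e = h \<bullet> d" "k = u \<bullet> d"
  note parts = U_D_H_R_S_def a_b_e_k_def
  have "(norm ((1 - q) *\<^sub>R u + m *\<^sub>R d - s *\<^sub>R h))\<^sup>2
      = (1 - q)\<^sup>2 * U + m\<^sup>2 * D + s\<^sup>2 * H + 2 * (1 - q) * m * k - 2 * s * (1 - q) * a - 2 * q * e"
    unfolding parts power2_norm_eq_inner q(1)
    by (simp add: inner_add_left inner_add_right inner_diff_left inner_diff_right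
        inner_commute power2_eq_square algebra_simps)
  moreover have "(norm (u + m *\<^sub>R d))\<^sup>2 = U + 2 * m * k + m\<^sup>2 * D"
    unfolding parts power2_norm_eq_inner
    by (simp add: inner_add_left inner_add_right inner_commute power2_eq_square algebra_simps)
  moreover have "c / 2 * (norm (\<rho> *\<^sub>R (p - s *\<^sub>R r)))\<^sup>2 = (1 - q) / 2 * (S - 2 * s * b + s\<^sup>2 * R)"
  proof -
    have "(norm (p - s *\<^sub>R r))\<^sup>2 = S - 2 * s * b + s\<^sup>2 * R"
      unfolding parts power2_norm_eq_inner
      by (simp add: inner_diff_left inner_diff_right inner_commute power2_eq_square algebra_simps)
    then show ?thesis
      by (simp add: power_mult_distrib flip: c(1))
  qed
  moreover have "(norm p)\<^sup>2 = S"
    by (simp add: parts power2_norm_eq_inner)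
  moreover have "F1 \<le> F' - s\<^sup>2 / 2 * (H + R)"
    using descent by (simp add: parts power2_norm_eq_inner)
  moreover have "q * (F' + m\<^sup>2 / 2 * D) \<le> q * e"
    using mult_left_mono[OF convex q(2)] by (simp add: parts power2_norm_eq_inner)
  moreover have "(1 - q) * (F' - F - q / 2 * (U + S)) \<le> (1 - q) * (s * (a + b))"
    using mult_left_mono[OF along_velocity, of "1 - q"] q(3)
    by (simp add: parts power2_norm_eq_inner)
  moreover have "(1 - q) * (1 + q) * S \<le> (1 - q) * c * S"
    using c(2) by (intro mult_right_mono) (auto simp: parts)
  moreover have "0 \<le> q * (s\<^sup>2 * R)"
    using q(2) by (auto simp: parts)
  ultimately show ?thesis
    by (simp add: power2_eq_square field_simps)
qed

theorem theorem11:
  fixes f :: "real ^ 'd \<Rightarrow> real"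
    and gradf :: "real ^ 'd \<Rightarrow> real ^ 'd"
    and V :: "(real ^ 'd) set"
    and P proj :: "real ^ 'd \<Rightarrow> real ^ 'd"
    and xstar x0 :: "real ^ 'd"
    and x x' g v :: "nat \<Rightarrow> real ^ 'd"
    and L \<mu> \<eta> \<rho> \<epsilon> :: real
    and k :: nat
  assumes grad_f: "\<And>z. GDERIV f z :> gradf z"
    and grad_cont: "continuous_on UNIV gradf"
    and L_pos: "L > 0"
    and grad_lipschitz: "L-lipschitz_on UNIV gradf"
    and f_bdd_below: "bdd_below (range f)"
    and mu_pos: "\<mu> > 0"
    and eta_pos: "0 < \<eta>"
    and eta_le: "\<eta> \<le> 1 / L"
    and rho: "\<rho> = (1 - sqrt (\<mu> * \<eta>)) / (1 + sqrt (\<mu> * \<eta>))"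
    and x_0: "x 0 = x0"
    and v_0: "v 0 = 0"
    and x'_n: "\<And>n. x' n = x n + sqrt \<eta> *\<^sub>R v n"
    and g_n: "\<And>n. g n = gradf (x' n)"
    and x_Suc: "\<And>n. x (Suc n) = x' n - \<eta> *\<^sub>R g n"
    and v_Suc: "\<And>n. v (Suc n) = \<rho> *\<^sub>R (v n - sqrt \<eta> *\<^sub>R g n)"
    and V_subspace: "subspace V"
    and V_dim: "dim V = k"
    and k_less: "k < CARD('d)"
    and P_proj: "orthogonal_projection_onto V P"
    and xstar_min_norm: "\<And>w. w \<in> V \<Longrightarrow> norm xstar \<le> norm (xstar + w)"
    and minimizers_nonempty: "minimizers f \<noteq> {}"
    and minimizers_affine: "minimizers f = (\<lambda>w. xstar + w) ` V"
    and proj_closest: "proj = closest_point (minimizers f)"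
    and proj_affine: "\<And>z. proj z = P z + xstar"
    and strong_convexity_to_minimizer:
      "\<And>z. gradf z \<bullet> (z - proj z)
             \<ge> f z - f (proj z) + \<mu> / 2 * (norm (z - proj z))\<^sup>2"
    and eps_condition:
      "\<And>z w. gradf (z + w) \<bullet> w \<ge> f (z + w) - f z - \<epsilon> / 2 * (norm w)\<^sup>2"
    and eps_le: "\<epsilon> \<le> sqrt (\<mu> / \<eta>)"
  shows "\<forall>n. f (x n) - (INF z. f z)
           \<le> (1 - sqrt (\<mu> * \<eta>)) ^ n
               * (f x0 - (INF z. f z) + \<mu> / 2 * (norm (x0 - proj x0))\<^sup>2)"
proof -
  define m s q where "m = sqrt \<mu>" and "s = sqrt \<eta>" and "q = sqrt (\<mu> * \<eta>)"
  define F where "F z = f z - (INF z. f z)" for z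
  \<comment> \<open>Division by zero makes this \<open>0\<close> for \<open>q = 1\<close>, where \<open>\<rho> = 0\<close>, so that
    \<open>c * \<rho>\<^sup>2 = 1 - q\<close> holds in that case as well.\<close>
  define c where "c = (1 + q)\<^sup>2 / (1 - q)"
  define dd where "dd z = z - proj z" for z
  have m2: "m\<^sup>2 = \<mu>" and s2: "s\<^sup>2 = \<eta>" and q_eq: "q = m * s"
    using mu_pos eta_pos by (simp_all add: m_def s_def q_def real_sqrt_mult)
  have q_nonneg: "0 \<le> q"
    using mu_pos eta_pos by (simp add: q_def)
  have F_nonneg: "0 \<le> F z" for z
    using f_bdd_below by (simp add: F_def cINF_lower)

  have linP: "linear P"
    using V_subspace P_proj by (rule linear_orthogonal_projection)
  have PV: "P z \<in> V" and Po: "w \<in> V \<Longrightarrow> (z - P z) \<bullet> w = 0" for z w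
    using P_proj by (auto simp: orthogonal_projection_onto_def orthogonal_def)
  have proj_in: "proj z \<in> minimizers f" for z
    unfolding proj_affine minimizers_affine using PV by (auto simp: add.commute)
  have F_proj: "f (proj z) = (INF z. f z)" for z
    using proj_in by (simp add: minimizers_def)
  \<comment> \<open>The closest-point map fixes the minimizer \<open>xstar\<close>, so \<open>P xstar = 0\<close>: the offset of the
    affine space is normal to \<open>V\<close>.\<close>
  have "xstar \<in> minimizers f"
    unfolding minimizers_affine using subspace_0[OF V_subspace] by force
  then have "proj xstar = xstar"
    unfolding proj_closest by (rule closest_point_self)
  then have "P xstar = 0"
    by (simp add: proj_affine)
  then have dd_orth: "dd z \<bullet> w = 0" if "w \<in> V" for z w
    using Po[OF that, of z] Po[OF that, of xstar]
    by (simp add: dd_def proj_affine inner_diff_left inner_add_left)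
  have dd_add: "dd (z + w) = dd z + (w - P w)" for z w
    by (simp add: dd_def proj_affine linear_add[OF linP])

  have "\<mu> \<le> L"
  proof -
    have "V \<noteq> UNIV"
      using V_dim k_less by auto
    then obtain y where y: "y \<notin> V"
      by blast
    have "dd (xstar + y) \<noteq> 0"
    proof
      assume "dd (xstar + y) = 0"
      then have "y = P (xstar + y)"
        by (simp add: dd_def proj_affine algebra_simps)
      with y PV show False
        by metis
    qed
    moreover have "(INF z. f z) \<le> f z" for z
      using F_nonneg[of z] by (simp add: F_def)
    ultimately show ?thesis
      using strong_convexity_constant_le_Lipschitz[OF grad_f grad_lipschitz L_pos,
          of "INF z. f z" "xstar + y" \<mu> "dd (xstar + y)"]
        strong_convexity_to_minimizer[of "xstar + y"]
      by (simp add: F_proj dd_def)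
  qed
  then have "\<mu> * \<eta> \<le> L * (1 / L)"
    using mu_pos eta_pos eta_le by (intro mult_mono) auto
  then have q_le: "q \<le> 1"
    using L_pos by (simp add: q_def)

  have rho_q: "\<rho> = (1 - q) / (1 + q)"
    by (simp add: rho q_def)
  have c_nonneg: "0 \<le> c"
    using q_le by (simp add: c_def)
  have c_rho: "c * \<rho>\<^sup>2 = 1 - q"
  proof (cases "q = 1")
    case False
    then show ?thesis
      using q_nonneg by (simp add: c_def rho_q power_divide) (simp add: power2_eq_square)
  qed (simp add: c_def)
  have c_ge: "(1 - q) * (1 + q) \<le> (1 - q) * c"
  proof (cases "q = 1")
    case False
    have "(1 - q) * (1 + q) \<le> (1 + q) * (1 + q)"
      using q_nonneg by (intro mult_right_mono) auto
    also have "\<dots> = (1 - q) * c"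
      using False by (simp add: c_def power2_eq_square)
    finally show ?thesis .
  qed simp
  have eps_eta: "\<epsilon> * \<eta> \<le> q"
  proof -
    have "\<epsilon> * \<eta> \<le> sqrt (\<mu> / \<eta>) * \<eta>"
      using eps_le eta_pos by (intro mult_right_mono) auto
    also have "\<dots> = q"
      using eta_pos real_sqrt_mult_self[of \<eta>]
      by (simp add: q_def real_sqrt_divide real_sqrt_mult field_simps)
    finally show ?thesis .
  qed

  define E where "E n = F (x n) + (norm ((v n - P (v n)) + m *\<^sub>R dd (x' n)))\<^sup>2 / 2
      + c / 2 * (norm (P (v n)))\<^sup>2" for n
  have split: "a \<bullet> b = (a - P a) \<bullet> (b - P b) + P a \<bullet> P b" for a b
    using Po[OF PV, of a b] Po[OF PV, of b a]
    by (simp add: inner_diff_left inner_diff_right inner_commute)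
  have split_norm: "(norm a)\<^sup>2 = (norm (a - P a))\<^sup>2 + (norm (P a))\<^sup>2" for a
    unfolding power2_norm_eq_inner by (rule split)
  have step: "E (Suc n) \<le> (1 - q) * E n" for n
  proof -
    let ?u = "v n - P (v n)" and ?h = "g n - P (g n)" and ?d = "dd (x' n)"
    have P_v: "P (v (Suc n)) = \<rho> *\<^sub>R (P (v n) - s *\<^sub>R P (g n))"
      by (simp add: v_Suc s_def linear_diff[OF linP] linear_scale[OF linP])
    have Q_v: "v (Suc n) - P (v (Suc n)) = \<rho> *\<^sub>R (?u - s *\<^sub>R ?h)"
      unfolding P_v by (simp add: v_Suc s_def algebra_simps)
    have "x' (Suc n) = x' n + (s *\<^sub>R v (Suc n) - \<eta> *\<^sub>R g n)"
      by (simp add: x'_n[of "Suc n"] x_Suc s_def)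
    then have x'_Suc: "dd (x' (Suc n)) = dd (x' n + (s *\<^sub>R v (Suc n) - \<eta> *\<^sub>R g n))"
      by simp
    have dd_Suc: "dd (x' (Suc n)) = ?d + (s *\<^sub>R (v (Suc n) - P (v (Suc n))) - \<eta> *\<^sub>R ?h)"
      unfolding x'_Suc dd_add linear_diff[OF linP] linear_scale[OF linP]
      by (simp add: algebra_simps)
    have "(v (Suc n) - P (v (Suc n))) + m *\<^sub>R dd (x' (Suc n))
        = ((1 + q) * \<rho>) *\<^sub>R (?u - s *\<^sub>R ?h) + m *\<^sub>R ?d - (q * s) *\<^sub>R ?h"
      unfolding dd_Suc Q_v q_eq s2[symmetric] by (simp add: algebra_simps power2_eq_square)
    also have "(1 + q) * \<rho> = 1 - q"
      using q_nonneg by (simp add: rho_q)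
    also have "(1 - q) *\<^sub>R (?u - s *\<^sub>R ?h) + m *\<^sub>R ?d - (q * s) *\<^sub>R ?h
        = (1 - q) *\<^sub>R ?u + m *\<^sub>R ?d - s *\<^sub>R ?h"
      by (simp add: algebra_simps)
    finally have normal: "(v (Suc n) - P (v (Suc n))) + m *\<^sub>R dd (x' (Suc n))
        = (1 - q) *\<^sub>R ?u + m *\<^sub>R ?d - s *\<^sub>R ?h" .
    show ?thesis
      unfolding E_def unfolding normal unfolding P_v
    proof (rule nesterov_energy_step[OF q_eq q_nonneg q_le c_rho c_ge])
      show "F (x (Suc n)) \<le> F (x' n) - s\<^sup>2 / 2 * ((norm ?h)\<^sup>2 + (norm (P (g n)))\<^sup>2)"
        using gradient_step_decrease[OF grad_f grad_lipschitz L_pos _ eta_le, of "x' n"] eta_pos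
        by (simp add: F_def x_Suc g_n s2 flip: split_norm)
      have "g n \<bullet> ?d = ?h \<bullet> ?d"
        using dd_orth[OF PV, of "x' n" "g n"]
        by (simp add: inner_diff_left inner_commute[of "P (g n)"])
      then show "F (x' n) + m\<^sup>2 / 2 * (norm ?d)\<^sup>2 \<le> ?h \<bullet> ?d"
        using strong_convexity_to_minimizer[of "x' n"]
        by (simp add: F_def F_proj m2 dd_def g_n)
      have "\<epsilon> * \<eta> * (norm (v n))\<^sup>2 \<le> q * (norm (v n))\<^sup>2"
        using eps_eta by (intro mult_right_mono) auto
      moreover have "F (x' n) - F (x n) - \<epsilon> / 2 * (\<eta> * (norm (v n))\<^sup>2) \<le> s * (g n \<bullet> v n)"
        using eps_condition[of "x n" "s *\<^sub>R v n"]
        by (simp add: F_def g_n x'_n s_def power_mult_distrib s2[unfolded s_def])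
      ultimately show "F (x' n) - F (x n) - q / 2 * ((norm ?u)\<^sup>2 + (norm (P (v n)))\<^sup>2)
          \<le> s * (?h \<bullet> ?u + P (g n) \<bullet> P (v n))"
        by (simp flip: split_norm split)
    qed
  qed
  have E_le: "E n \<le> (1 - q) ^ n * E 0" for n
  proof (induction n)
    case (Suc n)
    have "E (Suc n) \<le> (1 - q) * ((1 - q) ^ n * E 0)"
      using step[of n] mult_left_mono[OF Suc.IH, of "1 - q"] q_le by linarith
    then show ?case
      by (simp add: mult.assoc)
  qed simp
  have E_0: "E 0 = F x0 + \<mu> / 2 * (norm (x0 - proj x0))\<^sup>2"
    by (simp add: E_def v_0 x'_n x_0 linear_0[OF linP] dd_def power_mult_distrib m2)
  show ?thesis
  proof
    fix n
    have "F (x n) \<le> E n"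
      using c_nonneg by (simp add: E_def)
    also note E_le
    finally show "f (x n) - (INF z. f z) \<le> (1 - sqrt (\<mu> * \<eta>)) ^ n
        * (f x0 - (INF z. f z) + \<mu> / 2 * (norm (x0 - proj x0))\<^sup>2)"
      by (simp add: E_0 F_def q_def)
  qed
qed

end
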